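(* Let $1\le k_1<\cdots<k_s$ be integers with $k_s\ge 2$, and let $r=\lfloor\log_2(k_s)\rfloor+1$. Then $\Phi_{2^r}(x-1)$ divides $P_{k_1,\dots,k_s}(x)$, the characteristic polynomial of the minimal homogeneous linear recurrence with integer coefficients satisfied by the sequence $\{S_n\}_{n\in\mathbb{N}}$, where $$S_n=\sum_{j=0}^n(-1)^{\binom{j}{k_1}+\cdots+\binom{j}{k_s}}\binom{n}{j}.$$
   Context: $\mathbb{N}=\{1,2,3,\dots\}$. $S_n$ is the exponential sum of the symmetric Boolean function $\sigma_{n,k_1}+\cdots+\sigma_{n,k_s}$, where $\sigma_{n,k}$ is the elementary symmetric polynomial of degree $k$ in $n$ variables over $\mathbb{F}_2$. $\Phi_m$ is the $m$-th cyclotomic polynomial. A homogeneous linear recurrence $x_n=\sum_{i=1}^D a_ix_{n-i}$ with $a_i\in\mathbb{Z}$ has characteristic polynomial $x^D-\sum_{i=1}^D a_ix^{D-i}$; "minimal" means of least order. *)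

theory Defs
  imports Complex_Main "HOL-Computational_Algebra.Computational_Algebra"
begin

definition primitive_root_unity :: "nat \<Rightarrow> complex \<Rightarrow> bool" where
  "primitive_root_unity m z \<longleftrightarrow> z ^ m = 1 \<and> (\<forall>j. 0 < j \<and> j < m \<longrightarrow> z ^ j \<noteq> 1)"

definition cyclotomic :: "nat \<Rightarrow> int poly" where
  "cyclotomic m = (THE q. map_poly of_int q = (\<Prod>z | primitive_root_unity m z. [:- z, 1:]))"

text \<open>
  Sequences are indexed by the positive integers: the value at \<open>0\<close> is never used, and a recurrence
  of order \<open>D\<close> with coefficients \<open>a 1, \<dots>, a D\<close> is required exactly for the indices \<open>n > D\<close>.
\<close>

definition satisfies_recurrence :: "(nat \<Rightarrow> int) \<Rightarrow> nat \<Rightarrow> (nat \<Rightarrow> int) \<Rightarrow> bool" where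
  "satisfies_recurrence x D a \<longleftrightarrow> (\<forall>n>D. x n = (\<Sum>i=1..D. a i * x (n - i)))"

definition recurrence_char_poly :: "nat \<Rightarrow> (nat \<Rightarrow> int) \<Rightarrow> int poly" where
  "recurrence_char_poly D a = monom 1 D - (\<Sum>i=1..D. monom (a i) (D - i))"

definition minimal_recurrence :: "(nat \<Rightarrow> int) \<Rightarrow> nat \<Rightarrow> (nat \<Rightarrow> int) \<Rightarrow> bool" where
  "minimal_recurrence x D a \<longleftrightarrow>
     satisfies_recurrence x D a \<and> (\<forall>D' a'. satisfies_recurrence x D' a' \<longrightarrow> D \<le> D')"

text \<open>
  The description ranges over the polynomial, since \<open>a\<close> is irrelevant outside \<open>{1..D}\<close>.
\<close>

definition min_char_poly :: "(nat \<Rightarrow> int) \<Rightarrow> int poly" where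
  "min_char_poly x = (THE P. \<exists>D a. minimal_recurrence x D a \<and> P = recurrence_char_poly D a)"

definition symm_exp_sum :: "nat \<Rightarrow> (nat \<Rightarrow> nat) \<Rightarrow> nat \<Rightarrow> int" where
  "symm_exp_sum s k n = (\<Sum>j=0..n. (-1) ^ (\<Sum>i=1..s. j choose k i) * int (n choose j))"

end

(* Let f(j) be the sign in S_n, M = 2^(r-1) and Q(y) = P(1+y). Pairing f with polynomials linearly
   via y^j -> f(j) sends (1+y)^n to S_n, so the recurrence says that (1+y) Q(y) annihilates f under
   the shift action of Z[y]. By Lucas f has period 2M but not M, so f'(j) = f(j+M) - f(j) is a nonzero
   sequence killed by y^M + 1, the 2M-th cyclotomic polynomial. The annihilator of f' is a saturated
   ideal of Z[y] containing a monic polynomial, hence principal; since y^M + 1 is irreducible, it is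
   generated by y^M + 1. As (1+y) Q also kills f', y^M + 1 divides (1+y) Q and therefore Q.
   Principality of annihilators also makes the minimal recurrence over Z unique. *)

theory Submission
  imports Defs
begin

section \<open>Saturated ideals of integer polynomials\<close>

text \<open>The third clause compensates for Z[y] not being a principal ideal domain:
  pseudo-division gives results only up to a nonzero integer factor.\<close>

definition saturated_ideal :: "int poly set \<Rightarrow> bool" where
  "saturated_ideal I \<longleftrightarrow> (\<forall>p\<in>I. \<forall>q\<in>I. p - q \<in> I) \<and> (\<forall>p\<in>I. \<forall>q. q * p \<in> I) \<and>
     (\<forall>c p. c \<noteq> 0 \<longrightarrow> smult c p \<in> I \<longrightarrow> p \<in> I)"

text \<open>Gauss's lemma: as the content is multiplicative, all of \<open>c\<close> sits in the
  cofactor, where it cancels.\<close>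

lemma dvd_smult_primitive:
  fixes g p :: "int poly"
  assumes "content g = 1" "c \<noteq> 0" "g dvd smult c p"
  shows "g dvd p"
proof -
  from assms(3) obtain q where q: "smult c p = g * q" ..
  then have "content (smult c p) = content g * content q"
    by (simp add: content_mult)
  then have "c dvd content q"
    using assms(1) by (metis content_smult dvd_triv_left mult_1 normalize_dvd_iff)
  then have "[:c:] dvd q"
    by (simp add: const_poly_dvd_iff_dvd_content)
  then obtain q' where "q = smult c q'" by (auto simp: dvd_def)
  with q have "smult c p = smult c (g * q')" by simp
  then have "p = g * q'"
    using assms(2) by (simp add: smult_cancel)
  then show ?thesis by simp
qed

text \<open>The primitive part of a nonzero member of least degree generates: saturation keeps it in
  \<open>I\<close>, and a pseudo-remainder by it lies in \<open>I\<close>, so by minimality it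
  vanishes.\<close>

lemma saturated_ideal_generator:
  assumes I: "saturated_ideal I" and m: "m \<in> I" "lead_coeff m = 1"
  obtains g where "lead_coeff g = 1" "I = {p. g dvd p}"
proof -
  have diff: "p - q \<in> I" if "p \<in> I" "q \<in> I" for p q
    using I that by (auto simp: saturated_ideal_def)
  have mult: "q * p \<in> I" if "p \<in> I" for p q
    using I that by (auto simp: saturated_ideal_def)
  have sat: "p \<in> I" if "smult c p \<in> I" "c \<noteq> 0" for p c
    using I that by (auto simp: saturated_ideal_def)
  have "m \<in> I \<and> m \<noteq> 0" using m by auto
  then obtain g0 where g0: "g0 \<in> I" "g0 \<noteq> 0"
    and min: "\<And>h. h \<in> I \<Longrightarrow> h \<noteq> 0 \<Longrightarrow> degree g0 \<le> degree h"
    using ex_has_least_nat[of "\<lambda>p. p \<in> I \<and> p \<noteq> 0" m degree] by blast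
  define g where "g = primitive_part g0"
  have g: "g \<in> I" "g \<noteq> 0" "content g = 1" "degree g = degree g0"
    using g0 sat[of "content g0" g] by (auto simp: g_def)
  have gdvd: "g dvd p" if p: "p \<in> I" for p
  proof -
    obtain c q where cq: "c \<noteq> 0" "smult c p = g * q + pseudo_mod p g"
      using pseudo_mod(1)[OF g(2)] by blast
    have "pseudo_mod p g = [:c:] * p - q * g" using cq(2) by (simp add: mult.commute)
    then have "pseudo_mod p g \<in> I" using diff[OF mult[OF p, of "[:c:]"] mult[OF g(1), of q]] by simp
    then have "pseudo_mod p g = 0"
      using pseudo_mod(2)[OF g(2), of p] min g(4) by force
    with cq show ?thesis using dvd_smult_primitive[OF g(3) cq(1)] by simp
  qed
  \<comment> \<open>A divisor of the monic \<open>m\<close> has leading coefficient 1 or -1;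
    multiplying by that coefficient makes it monic.\<close>
  from gdvd[OF m(1)] obtain h where "m = g * h" ..
  then have "lead_coeff g * lead_coeff h = 1" using m(2) by (simp add: lead_coeff_mult)
  then have "lead_coeff g dvd 1" by (metis dvd_triv_left)
  then have sq: "lead_coeff g * lead_coeff g = 1" by (auto simp: zdvd1_eq abs_if split: if_splits)
  define g' where "g' = smult (lead_coeff g) g"
  have "lead_coeff g' = 1" using sq g(2) by (simp add: g'_def)
  moreover have "g' dvd p \<longleftrightarrow> g dvd p" for p
    unfolding g'_def by (metis dvd_refl dvd_trans smult_dvd_cancel smult_smult sq smult_1_left)
  ultimately show ?thesis
    using that[of g'] gdvd mult[OF g(1)] by (auto simp: dvd_def mult.commute)
qed

section \<open>Annihilators of sequences\<close>

text \<open>The linear functional on Z[y] that sends y^i to \<open>x i\<close>.\<close>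

definition pairing :: "(nat \<Rightarrow> int) \<Rightarrow> int poly \<Rightarrow> int" where
  "pairing x p = (\<Sum>i\<le>degree p. coeff p i * x i)"

text \<open>The annihilator of \<open>x\<close> in Z[y], where y acts as the shift.\<close>

definition annihilators :: "(nat \<Rightarrow> int) \<Rightarrow> int poly set" where
  "annihilators x = {p. \<forall>n. pairing (\<lambda>i. x (n + i)) p = 0}"

lemma pairing_eq_sum:
  assumes "degree p \<le> d"
  shows "pairing x p = (\<Sum>i\<le>d. coeff p i * x i)"
  unfolding pairing_def using assms
  by (intro sum.mono_neutral_left) (auto simp: coeff_eq_0)

lemma pairing_0 [simp]: "pairing x 0 = 0"
  by (simp add: pairing_def)

lemma pairing_add: "pairing x (p + q) = pairing x p + pairing x q"
proof -
  let ?d = "max (degree p) (degree q)"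
  have "degree (p + q) \<le> ?d" by (rule degree_add_le_max)
  then show ?thesis
    by (simp add: pairing_eq_sum[of _ ?d] sum.distrib algebra_simps)
qed

lemma pairing_smult [simp]: "pairing x (smult c p) = c * pairing x p"
  by (simp add: pairing_eq_sum[of "smult c p" "degree p"] pairing_def sum_distrib_left mult.assoc)

lemma pairing_diff: "pairing x (p - q) = pairing x p - pairing x q"
  using pairing_add[of x "p - q" q] by simp

lemma pairing_sum: "pairing x (\<Sum>i\<in>A. p i) = (\<Sum>i\<in>A. pairing x (p i))"
  by (induction A rule: infinite_finite_induct) (auto simp: pairing_add)

lemma pairing_monom [simp]: "pairing x (monom c d) = c * x d"
proof -
  have "pairing x (monom c d) = (\<Sum>i\<le>d. coeff (monom c d) i * x i)"
    by (simp only: pairing_eq_sum degree_monom_le)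
  also have "\<dots> = (\<Sum>i\<le>d. if i = d then c * x i else 0)"
    by (rule sum.cong) auto
  finally show ?thesis by simp
qed

lemma pairing_pCons: "pairing x (pCons a p) = a * x 0 + pairing (\<lambda>i. x (Suc i)) p"
  by (subst pairing_eq_sum[OF degree_pCons_le])
    (simp add: sum.atMost_Suc_shift pairing_def del: sum.atMost_Suc)

lemma pairing_diff_left: "pairing (\<lambda>i. x i - y i) p = pairing x p - pairing y p"
  by (simp add: pairing_def algebra_simps sum_subtractf)

text \<open>A factor y in \<open>q\<close> moves \<open>n\<close> to \<open>Suc n\<close>, so
  vanishing at every shift gives vanishing on the whole principal ideal of \<open>p\<close>.\<close>

lemma pairing_mult_annihilator:
  assumes "p \<in> annihilators x"
  shows "pairing (\<lambda>i. x (n + i)) (q * p) = 0"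
proof (induction q arbitrary: n)
  case (pCons a q)
  have "pairing (\<lambda>i. x (n + i)) p = 0"
    using assms by (simp add: annihilators_def)
  with pCons.IH[of "Suc n"] show ?case
    by (simp add: pairing_add pairing_pCons)
qed simp

lemma saturated_ideal_annihilators: "saturated_ideal (annihilators x)"
proof -
  have "q * p \<in> annihilators x" if "p \<in> annihilators x" for p q
    using pairing_mult_annihilator[OF that] by (auto simp: annihilators_def)
  then show ?thesis
    by (auto simp: saturated_ideal_def) (auto simp: annihilators_def pairing_diff)
qed

text \<open>Converse of \<open>pairing_mult_annihilator\<close>: taking y^n for \<open>q\<close>
  recovers the condition at shift \<open>n\<close>.\<close>

lemma annihilatorsI:
  assumes "\<And>q. pairing x (q * p) = 0"
  shows "p \<in> annihilators x"
proof -
  have shift: "pairing (\<lambda>i. x (n + i)) p = pairing x (monom 1 n * p)" for n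
  proof (induction n arbitrary: x)
    case (Suc n)
    show ?case using Suc[of "\<lambda>i. x (Suc i)"]
      by (simp add: monom_Suc pairing_pCons)
  qed simp
  show ?thesis using assms by (simp add: annihilators_def shift)
qed

section \<open>The minimal recurrence of an integer sequence\<close>

lemma coeff_recurrence_char_poly:
  "coeff (recurrence_char_poly D a) j = (if j = D then 1 else if j < D then - a (D - j) else 0)"
proof -
  have "(\<Sum>i=1..D. coeff (monom (a i) (D - i)) j) =
      (\<Sum>i=1..D. if i = D - j \<and> j < D then a i else 0)"
    by (intro sum.cong) auto
  also have "\<dots> = (if j < D then a (D - j) else 0)"
    by auto
  finally show ?thesis
    by (auto simp: recurrence_char_poly_def coeff_sum)
qed

lemma degree_recurrence_char_poly [simp]: "degree (recurrence_char_poly D a) = D"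
  by (intro antisym degree_le le_degree) (auto simp: coeff_recurrence_char_poly)

lemma lead_coeff_recurrence_char_poly: "lead_coeff (recurrence_char_poly D a) = 1"
  by (simp add: coeff_recurrence_char_poly)

lemma monic_eq_recurrence_char_poly:
  assumes "lead_coeff p = 1"
  shows "p = recurrence_char_poly (degree p) (\<lambda>i. - coeff p (degree p - i))"
  using assms by (intro poly_eqI) (auto simp: coeff_recurrence_char_poly coeff_eq_0)

text \<open>Sequences start at index 1, whence the \<open>Suc\<close>: the indices above
  \<open>D\<close> are exactly the \<open>Suc n + D\<close>.\<close>

lemma satisfies_recurrence_iff_annihilator:
  "satisfies_recurrence x D a \<longleftrightarrow> recurrence_char_poly D a \<in> annihilators (\<lambda>n. x (Suc n))"
proof -
  have "pairing (\<lambda>i. x (Suc (n + i))) (recurrence_char_poly D a) =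
      x (Suc n + D) - (\<Sum>i=1..D. a i * x (Suc n + D - i))" for n
    by (auto simp: recurrence_char_poly_def pairing_diff pairing_sum Suc_diff_le intro!: sum.cong)
  moreover have "(\<forall>n>D. Q n) \<longleftrightarrow> (\<forall>n. Q (Suc n + D))" for Q
    by (metis add.commute add_Suc less_add_Suc1 less_imp_Suc_add)
  ultimately show ?thesis
    by (simp add: satisfies_recurrence_def annihilators_def)
qed

text \<open>The monic generator of the annihilator ideal is the only characteristic polynomial of a
  recurrence of least order, so the description in \<open>min_char_poly\<close> denotes it.\<close>

lemma min_char_poly_annihilates:
  assumes "m \<in> annihilators (\<lambda>n. x (Suc n))" "lead_coeff m = 1"
  shows "min_char_poly x \<in> annihilators (\<lambda>n. x (Suc n))"
proof -
  obtain g where g: "lead_coeff g = 1" "annihilators (\<lambda>n. x (Suc n)) = {p. g dvd p}"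
    using saturated_ideal_generator[OF saturated_ideal_annihilators assms] .
  have dvd: "g dvd recurrence_char_poly D a" if "satisfies_recurrence x D a" for D a
    using that g by (simp add: satisfies_recurrence_iff_annihilator)
  have deg: "degree g \<le> D" if "satisfies_recurrence x D a" for D a
    using dvd_imp_degree_le[OF dvd[OF that]] lead_coeff_recurrence_char_poly[of D a] by force
  define b where "b i = - coeff g (degree g - i)" for i
  have gb: "g = recurrence_char_poly (degree g) b"
    unfolding b_def by (rule monic_eq_recurrence_char_poly) fact
  then have sat: "satisfies_recurrence x (degree g) b"
    using g by (simp add: satisfies_recurrence_iff_annihilator)
  then have min: "minimal_recurrence x (degree g) b"
    using deg by (auto simp: minimal_recurrence_def)
  have uniq: "recurrence_char_poly D a = g" if "minimal_recurrence x D a" for D a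
  proof -
    have s: "satisfies_recurrence x D a" and "D \<le> degree g"
      using that sat by (auto simp: minimal_recurrence_def)
    with deg have D: "D = degree g" by fastforce
    obtain h where h: "recurrence_char_poly D a = g * h" using dvd[OF s] ..
    then have lc: "lead_coeff h = 1"
      using g(1) lead_coeff_recurrence_char_poly[of D a] by (simp add: lead_coeff_mult)
    then have "degree g + degree h = D"
      using h g(1) degree_recurrence_char_poly[of D a] by (metis degree_mult_eq leading_coeff_0_iff zero_neq_one)
    with D lc have "h = 1" by (auto elim!: degree_eq_zeroE)
    with h show ?thesis by simp
  qed
  have "min_char_poly x = g"
    unfolding min_char_poly_def
    by (rule the_equality) (use min gb uniq in metis)+
  with g show ?thesis by simp
qed

section \<open>Irreducibility of the cyclotomic polynomials of two-power order\<close>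

abbreviation complex_poly :: "int poly \<Rightarrow> complex poly" where
  "complex_poly \<equiv> map_poly of_int"

lemma complex_poly_mult: "complex_poly (p * q) = complex_poly p * complex_poly q"
  by (intro poly_eqI) (simp add: coeff_map_poly coeff_mult)

lemma complex_poly_diff: "complex_poly (p - q) = complex_poly p - complex_poly q"
  by (intro poly_eqI) (simp add: coeff_map_poly)

lemma complex_poly_inject: "complex_poly p = complex_poly q \<longleftrightarrow> p = q"
  by (auto simp: poly_eq_iff coeff_map_poly)

lemma even_odd_parts:
  fixes p :: "int poly"
  obtains e d where "poly p 1 = poly e 1 + poly d 1"
    and "\<And>z. poly (complex_poly p) z = poly (complex_poly e) (z\<^sup>2) + z * poly (complex_poly d) (z\<^sup>2)"
proof (induction p arbitrary: thesis)
  case 0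
  show ?case by (rule 0[of 0 0]) auto
next
  case (pCons a p)
  obtain e d where "poly p 1 = poly e 1 + poly d 1"
    and "\<And>z. poly (complex_poly p) z = poly (complex_poly e) (z\<^sup>2) + z * poly (complex_poly d) (z\<^sup>2)"
    using pCons.IH by blast
  \<comment> \<open>Multiplication by the variable swaps the even and the odd part.\<close>
  then show ?case
    by (intro pCons.prems[of "pCons a d" e])
      (auto simp: map_poly_pCons algebra_simps power2_eq_square)
qed

text \<open>
  For \<open>p = e(x\<^sup>2) + x d(x\<^sup>2)\<close> the product \<open>p(x) p(-x)\<close> is \<open>b(x\<^sup>2)\<close> with \<open>b = e\<^sup>2 - x d\<^sup>2\<close>; passing from \<open>p\<close>
  to \<open>b\<close> squares the root and keeps the parity of the value at \<open>1\<close>.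
\<close>

lemma even_poly_1_if_two_power_root:
  fixes p :: "int poly" and z :: complex
  assumes "poly (complex_poly p) z = 0" "z ^ (2 ^ m) = - 1"
  shows "even (poly p 1)"
  using assms
proof (induction m arbitrary: p z)
  case 0
  then have z: "z = - 1" by simp
  \<comment> \<open>The root is -1 here, and an integer polynomial takes values of equal parity at 1
    and -1.\<close>
  have "poly (complex_poly p) (- 1) = of_int (poly p (- 1))"
    by (induction p) (auto simp: map_poly_pCons)
  with 0 z have "poly p (- 1) = 0" by simp
  moreover have "even (poly p 1 - poly p (- 1))"
    by (induction p) auto
  ultimately show ?case by simp
next
  case (Suc m)
  obtain e d where 1: "poly p 1 = poly e 1 + poly d 1"
    and z: "\<And>z. poly (complex_poly p) z = poly (complex_poly e) (z\<^sup>2) + z * poly (complex_poly d) (z\<^sup>2)"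
    using even_odd_parts[of p] by blast
  let ?b = "e * e - [:0, 1:] * (d * d)"
  have "poly (complex_poly e) (z\<^sup>2) = - z * poly (complex_poly d) (z\<^sup>2)"
    using Suc.prems(1) z[of z] by (simp add: add_eq_0_iff2)
  then have "poly (complex_poly ?b) (z\<^sup>2) = 0"
    by (simp only: complex_poly_diff complex_poly_mult poly_diff poly_mult)
      (simp add: map_poly_pCons power2_eq_square)
  moreover have "(z\<^sup>2) ^ 2 ^ m = - 1"
    using Suc.prems(2) by (simp flip: power_mult)
  ultimately have "even (poly ?b 1)" by (rule Suc.IH)
  with 1 show ?case by simp
qed

lemma degree_two_power_cyclotomic: "degree (monom 1 (2 ^ m) + 1 :: 'a::comm_ring_1 poly) = 2 ^ m"
  by (subst degree_add_eq_left) (auto simp: degree_monom_eq)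

lemma lead_coeff_two_power_cyclotomic:
  "lead_coeff (monom 1 (2 ^ m) + 1 :: 'a::comm_ring_1 poly) = 1"
  by (simp add: degree_two_power_cyclotomic)

lemma complex_poly_two_power_cyclotomic: "complex_poly (monom 1 d + 1) = monom 1 d + 1"
  by (intro poly_eqI) (auto simp: coeff_map_poly)

text \<open>Nonconstant factors have even values at 1, but the product has value 2 there. So one
  factor is constant, and it is a unit because the product is monic.\<close>

lemma irreducible_two_power_cyclotomic: "irreducible (monom 1 (2 ^ m) + 1 :: int poly)"
proof (rule irreducibleI)
  let ?c = "monom 1 (2 ^ m) + 1 :: int poly"
  show "?c \<noteq> 0"
    using lead_coeff_two_power_cyclotomic[where 'a = int, of m] by force
  show "\<not> is_unit ?c"
    using degree_two_power_cyclotomic[where 'a = int, of m] by (auto simp: is_unit_iff_degree is_unit_poly_iff)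
  fix g h :: "int poly" assume gh: "?c = g * h"
  then have lc: "lead_coeff g * lead_coeff h = 1"
    using lead_coeff_two_power_cyclotomic[where 'a = int, of m] by (simp add: lead_coeff_mult)
  have even: "even (poly p 1)" if p: "p dvd ?c" "degree p \<noteq> 0" for p
  proof -
    have "degree (complex_poly p) \<noteq> 0" using p(2) by (simp add: degree_map_poly)
    then obtain z where z: "poly (complex_poly p) z = 0"
      using fundamental_theorem_of_algebra[of "complex_poly p"] by (auto simp: constant_degree)
    have "complex_poly p dvd complex_poly ?c"
      using p(1) by (auto simp: dvd_def complex_poly_mult)
    then have "poly (complex_poly ?c) z = 0" using z by (auto simp: dvd_def)
    then have "z ^ (2 ^ m) = - 1"
      by (simp add: complex_poly_two_power_cyclotomic poly_monom eq_neg_iff_add_eq_0)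
    with z show ?thesis by (rule even_poly_1_if_two_power_root)
  qed
  have "poly g 1 * poly h 1 = 2"
    using arg_cong[OF gh, of "\<lambda>p. poly p 1"] by (simp add: poly_monom)
  then have "\<not> (even (poly g 1) \<and> even (poly h 1))"
    by (auto elim!: evenE) presburger
  then consider "degree g = 0" | "degree h = 0"
    using even[of g] even[of h] gh by fastforce
  moreover have "lead_coeff g dvd 1" "lead_coeff h dvd 1"
    using lc by (metis dvd_triv_left, metis dvd_triv_right)
  ultimately show "is_unit g \<or> is_unit h"
    by cases (auto elim!: degree_eq_zeroE simp: is_unit_const_poly_iff)
qed

lemma primitive_root_unity_two_power:
  "primitive_root_unity (2 ^ Suc m) z \<longleftrightarrow> z ^ (2 ^ m) = - 1"
proof
  assume z: "primitive_root_unity (2 ^ Suc m) z"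
  then have "(z ^ 2 ^ m)\<^sup>2 = 1"
    by (simp add: primitive_root_unity_def power_mult[symmetric] mult.commute)
  moreover have "z ^ 2 ^ m \<noteq> 1"
    using z by (auto simp: primitive_root_unity_def)
  ultimately show "z ^ 2 ^ m = - 1"
    by (simp add: power2_eq_1_iff)
next
  assume z: "z ^ (2 ^ m) = - 1"
  have "z ^ j \<noteq> 1" if j: "0 < j" "j < 2 ^ Suc m" for j
  proof
    assume 1: "z ^ j = 1"
    \<comment> \<open>With \<open>t\<close> at most \<open>m\<close>, raising
      \<open>z ^ j = 1\<close> to the power \<open>2 ^ (m - t)\<close> gives 1 = (-1)^u, which is
      impossible for odd \<open>u\<close>.\<close>
    obtain t u where tu: "j = 2 ^ t * u" "odd u"
      using j(1) by (metis multiplicity_decompose' bot_nat_0.not_eq_extremum nat_dvd_1_iff_1 numeral_eq_one_iff semiring_norm(85))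
    have "(2::nat) ^ t < 2 ^ Suc m"
      using j tu by (metis dual_order.strict_trans2 dvd_imp_le dvd_triv_left)
    then have "t \<le> m" by (simp add: power_strict_increasing_iff less_Suc_eq_le del: power_Suc)
    then have "j * 2 ^ (m - t) = 2 ^ m * u"
      using tu by (simp add: mult.commute mult.left_commute flip: power_add)
    then have "(z ^ j) ^ 2 ^ (m - t) = (z ^ 2 ^ m) ^ u"
      by (simp flip: power_mult)
    with 1 z tu(2) show False by simp
  qed
  moreover have "z ^ 2 ^ Suc m = 1"
    using z by (simp add: power_mult mult.commute[of 2])
  ultimately show "primitive_root_unity (2 ^ Suc m) z"
    by (simp add: primitive_root_unity_def)
qed

text \<open>The roots are the primitive roots of unity in question, and they are simple because the
  derivative vanishes at most at 0.\<close>

lemma cyclotomic_two_power: "cyclotomic (2 ^ Suc m) = monom 1 (2 ^ m) + 1"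
proof -
  let ?c = "monom 1 (2 ^ m) + 1 :: complex poly"
  have "rsquarefree ?c"
    unfolding rsquarefree_roots
  proof (intro allI notI, elim conjE)
    fix z assume "poly ?c z = 0" "poly (pderiv ?c) z = 0"
    then show False
      by (auto simp: poly_monom pderiv_add pderiv_monom power_0_left split: if_splits)
  qed
  then have "(\<Prod>z | poly ?c z = 0. [:- z, 1:]) = ?c"
    using complex_poly_decompose_rsquarefree[of ?c] by (simp add: degree_two_power_cyclotomic)
  moreover have "poly ?c z = 0 \<longleftrightarrow> primitive_root_unity (2 ^ Suc m) z" for z
    unfolding primitive_root_unity_two_power
    by (simp add: poly_monom eq_neg_iff_add_eq_0)
  ultimately have "(\<Prod>z | primitive_root_unity (2 ^ Suc m) z. [:- z, 1:]) = ?c"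
    by simp
  then show ?thesis
    unfolding cyclotomic_def complex_poly_two_power_cyclotomic[symmetric]
    by (simp add: complex_poly_inject del: power_Suc)
qed

section \<open>Parities of binomial coefficients\<close>

text \<open>By the absorption identity \<open>2 ^ m\<close> divides
  \<open>t * (2 ^ m choose t)\<close>; an odd binomial coefficient would force it to divide
  \<open>t\<close>.\<close>

lemma even_two_power_choose:
  assumes "0 < t" "t < 2 ^ m"
  shows "even ((2::nat) ^ m choose t)"
proof (rule ccontr)
  assume "odd ((2::nat) ^ m choose t)"
  then have "coprime ((2::nat) ^ m) (2 ^ m choose t)"
    by simp
  moreover obtain t' where t': "t = Suc t'"
    using assms(1) gr0_implies_Suc by blast
  then have "2 ^ m dvd t * (2 ^ m choose t)"
    by (simp only: binomial_absorption) simp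
  ultimately have "2 ^ m dvd t"
    by (simp add: coprime_dvd_mult_left_iff)
  with assms show False by (auto dest: dvd_imp_le)
qed

text \<open>Modulo 2, (1+y)^(2^m) is 1 + y^(2^m), so only the terms at 0 and \<open>2 ^ m\<close> of
  Vandermonde's sum survive.\<close>

lemma even_add_two_power_choose:
  "even (j + 2 ^ m choose k) \<longleftrightarrow>
     even ((j choose k) + (if 2 ^ m \<le> k then j choose (k - 2 ^ m) else 0))"
proof -
  let ?f = "\<lambda>t::nat. (2 ^ m choose t) * (j choose (k - t))"
  have "(j + 2 ^ m choose k) = sum ?f {..k}"
    by (simp add: vandermonde add.commute)
  also have "{..k} = ({0} \<union> {t. t = 2 ^ m \<and> t \<le> k}) \<union> {t. 0 < t \<and> t \<le> k \<and> t \<noteq> 2 ^ m}"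
    by auto
  also have "sum ?f \<dots> = sum ?f ({0} \<union> {t. t = 2 ^ m \<and> t \<le> k}) + sum ?f {t. 0 < t \<and> t \<le> k \<and> t \<noteq> 2 ^ m}"
    by (rule sum.union_disjoint) auto
  also have "sum ?f ({0} \<union> {t. t = 2 ^ m \<and> t \<le> k}) =
      (j choose k) + (if 2 ^ m \<le> k then j choose (k - 2 ^ m) else 0)"
    by (subst sum.union_disjoint) (auto simp: conj_commute Collect_conv_if cong: conj_cong)
  finally have *: "(j + 2 ^ m choose k) =
      (j choose k) + (if 2 ^ m \<le> k then j choose (k - 2 ^ m) else 0) +
      sum ?f {t. 0 < t \<and> t \<le> k \<and> t \<noteq> 2 ^ m}" .
  have "even (sum ?f {t. 0 < t \<and> t \<le> k \<and> t \<noteq> 2 ^ m})"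
  proof (rule dvd_sum, clarify)
    fix t :: nat assume t: "0 < t" "t \<noteq> 2 ^ m"
    show "even (?f t)"
    proof (cases "t < 2 ^ m")
      case True
      then show ?thesis using even_two_power_choose t by simp
    next
      case False
      then show ?thesis using t by (simp add: binomial_eq_0)
    qed
  qed
  with * show ?thesis by simp
qed

lemma even_sum_cong:
  fixes f g :: "'a \<Rightarrow> nat"
  assumes "\<And>i. i \<in> A \<Longrightarrow> even (f i) \<longleftrightarrow> even (g i)"
  shows "even (sum f A) \<longleftrightarrow> even (sum g A)"
  using assms by (induction A rule: infinite_finite_induct) auto

section \<open>Binomial transforms\<close>

lemma pairing_binomial_power:
  "pairing f ([:1, 1:] ^ n) = (\<Sum>j=0..n. f j * int (n choose j))"
proof -
  have d: "degree ([:1, 1:] ^ n :: int poly) \<le> n"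
    using degree_power_le[of "[:1, 1:] :: int poly" n] by simp
  show ?thesis
    unfolding pairing_eq_sum[OF d]
    by (rule sum.cong) (auto simp: coeff_linear_poly_power mult.commute)
qed

text \<open>Advancing the index of \<open>y\<close> multiplies by \<open>[:1, 1:]\<close> on the
  side of \<open>f\<close>, so the shift on \<open>y\<close> corresponds to 1 plus the shift on
  \<open>f\<close>.\<close>

lemma pairing_binomial_transform:
  assumes "\<And>n. y n = pairing f ([:1, 1:] ^ n)"
  shows "pairing (\<lambda>i. y (n + i)) p = pairing f ([:1, 1:] ^ n * pcompose p [:1, 1:])"
proof (induction p arbitrary: n)
  case (pCons a p)
  have "pairing (\<lambda>i. y (n + i)) (pCons a p) = a * y n + pairing (\<lambda>i. y (Suc n + i)) p"
    by (simp add: pairing_pCons)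
  also have "\<dots> = pairing f (smult a ([:1, 1:] ^ n) + [:1, 1:] ^ Suc n * pcompose p [:1, 1:])"
    by (simp only: pCons.IH pairing_add pairing_smult assms[of n])
  also have "smult a ([:1, 1:] ^ n) + [:1, 1:] ^ Suc n * pcompose p [:1, 1:] =
      [:1, 1:] ^ n * pcompose (pCons a p) [:1, 1:]"
    by (simp add: pcompose_pCons algebra_simps)
  finally show ?case .
qed simp

lemma pcompose_power: "pcompose (p ^ n) q = pcompose p q ^ n"
  for p q :: "'a::comm_ring_1 poly"
  by (induction n) (simp_all add: pcompose_1 pcompose_mult)

theorem mainTheorem5:
  fixes s r :: nat and k :: "nat \<Rightarrow> nat"
  assumes "1 \<le> s"
    and "1 \<le> k 1"
    and "strict_mono_on {1..s} k"
    and "2 \<le> k s"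
    and "r = nat \<lfloor>log 2 (real (k s))\<rfloor> + 1"
  shows "pcompose (cyclotomic (2 ^ r)) [:-1, 1:] dvd min_char_poly (symm_exp_sum s k)"
proof -
  define m where "m = nat \<lfloor>log 2 (real (k s))\<rfloor>"
  have r: "r = Suc m" using assms(5) by (simp add: m_def)
  have "\<lfloor>log 2 (real (k s))\<rfloor> = int m"
    using assms(4) by (simp add: m_def)
  then have ks: "2 ^ m \<le> k s" "k s < 2 ^ Suc m"
    using floor_log_nat_eq_powr_iff[of 2 "k s" m] assms(4) by simp_all
  \<comment> \<open>This gives \<open>c\<close> degree at least 2, so that it cannot divide
    \<open>[:1, 1:]\<close> at the end.\<close>
  have "m \<noteq> 0" using ks assms(4) by (intro notI) simp
  have k_less: "k i < 2 ^ Suc m" if "i \<in> {1..s}" for i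
    using strict_mono_onD[OF assms(3) that, of s] that ks(2) by (cases "i = s") auto

  \<comment> \<open>The sign sequence has period \<open>2 ^ Suc m\<close> but not
    \<open>2 ^ m\<close>\<close>
  define e where "e j = (\<Sum>i=1..s. j choose k i)" for j
  define f :: "nat \<Rightarrow> int" where "f j = (- 1) ^ e j" for j
  define f' where "f' j = f (j + 2 ^ m) - f j" for j
  define c :: "int poly" where "c = monom 1 (2 ^ m) + 1"

  have "even (e (j + 2 ^ Suc m)) \<longleftrightarrow> even (e j)" for j
    unfolding e_def
    by (rule even_sum_cong) (simp only: even_add_two_power_choose if_False linorder_not_le[THEN iffD2, OF k_less] add_0_right)
  then have period: "f (j + 2 ^ Suc m) = f j" for j
    by (simp add: f_def minus_one_power_iff)

  text \<open>At \<open>j = k i0 - 2 ^ m\<close>, with \<open>k i0\<close> the least exponent that is at least \<open>2 ^ m\<close>, the shift by \<open>2 ^ m\<close>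
    changes the parity of exactly one of the binomial coefficients.\<close>
  define i0 where "i0 = (LEAST i. i \<in> {1..s} \<and> 2 ^ m \<le> k i)"
  have i0: "i0 \<in> {1..s} \<and> 2 ^ m \<le> k i0"
    unfolding i0_def by (rule LeastI[of _ s]) (use assms(1) ks in auto)
  define j0 where "j0 = k i0 - 2 ^ m"
  have "(if 2 ^ m \<le> k i then j0 choose (k i - 2 ^ m) else 0) = (if i = i0 then 1 else 0)"
    if i: "i \<in> {1..s}" for i
  \<comment> \<open>By minimality of \<open>i0\<close>, any other such \<open>i\<close> comes after
    it; then \<open>k i - 2 ^ m\<close> exceeds \<open>j0\<close> and the coefficient is 0.\<close>
  proof (cases "2 ^ m \<le> k i \<and> i \<noteq> i0")
    case True
    then have "i0 < i" using i Least_le[of "\<lambda>i. i \<in> {1..s} \<and> 2 ^ m \<le> k i" i]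
      by (simp add: i0_def)
    then have "k i0 < k i" using strict_mono_onD[OF assms(3)] i i0 by blast
    then have "j0 < k i - 2 ^ m" unfolding j0_def using i0 by (intro diff_less_mono) auto
    then show ?thesis using True by (simp add: binomial_eq_0)
  next
    case False
    then show ?thesis using i0 by (cases "i = i0") (simp_all add: j0_def)
  qed
  then have "(\<Sum>i=1..s. if 2 ^ m \<le> k i then j0 choose (k i - 2 ^ m) else 0) =
      (\<Sum>i=1..s. if i = i0 then 1 else 0)"
    by (rule sum.cong[OF refl])
  also have "\<dots> = 1"
    using i0 by simp
  finally have "(\<Sum>i=1..s. if 2 ^ m \<le> k i then j0 choose (k i - 2 ^ m) else 0) = 1" .
  moreover have "even (e (j0 + 2 ^ m)) \<longleftrightarrow>
      even (\<Sum>i=1..s. (j0 choose k i) + (if 2 ^ m \<le> k i then j0 choose (k i - 2 ^ m) else 0))"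
    unfolding e_def by (rule even_sum_cong) (rule even_add_two_power_choose)
  ultimately have "even (e (j0 + 2 ^ m)) \<longleftrightarrow> odd (e j0)"
    by (simp only: sum.distrib e_def) simp
  then have f'_j0: "f' j0 \<noteq> 0"
    by (auto simp: f'_def f_def minus_one_power_iff)

  \<comment> \<open>Transfer of recurrences from the exponential sums to the sign sequence\<close>
  define x where "x = symm_exp_sum s k"
  have x: "x n = pairing f ([:1, 1:] ^ n)" for n
    by (simp add: x_def symm_exp_sum_def pairing_binomial_power f_def e_def)
  have shift_x: "pairing (\<lambda>i. x (Suc (n + i))) p = pairing f ([:1, 1:] ^ Suc n * pcompose p [:1, 1:])"
    for n p using pairing_binomial_transform[OF x, of "Suc n" p] by simp

  \<comment> \<open>The monic annihilator needed for \<open>min_char_poly_annihilates\<close>: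
    substituting 1 + y turns it into y^(2^(m+1)) - 1, which expresses the period of
    \<open>f\<close>.\<close>
  define a :: "int poly" where "a = [:- 1, 1:] ^ 2 ^ Suc m - 1"
  have a: "pcompose a [:1, 1:] = monom 1 (2 ^ Suc m) - 1"
    by (simp add: a_def pcompose_diff pcompose_power pcompose_pCons monom_altdef pcompose_1 del: power_Suc)
  have "monom 1 (2 ^ Suc m) - 1 \<in> annihilators f"
    using period by (simp add: annihilators_def pairing_diff one_pCons pairing_pCons add.assoc[symmetric] del: power_Suc)
  then have "a \<in> annihilators (\<lambda>n. x (Suc n))"
    using pairing_mult_annihilator[where n = 0] by (simp add: annihilators_def shift_x a del: power_Suc)
  moreover have "lead_coeff a = 1"
  proof -
    have "degree ([:- 1, 1:] ^ 2 ^ Suc m :: int poly) = 2 ^ Suc m"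
      by (subst degree_power_eq) auto
    then have "lead_coeff (- 1 + [:- 1, 1:] ^ 2 ^ Suc m :: int poly) = lead_coeff ([:- 1, 1:] ^ 2 ^ Suc m :: int poly)"
      by (intro lead_coeff_add_le) (simp del: power_Suc)
    also have "\<dots> = 1"
      by (subst lead_coeff_power) simp
    finally show ?thesis by (simp add: a_def del: power_Suc)
  qed
  ultimately have P: "min_char_poly x \<in> annihilators (\<lambda>n. x (Suc n))"
    by (rule min_char_poly_annihilates)

  define q where "q = pcompose (min_char_poly x) [:1, 1:]"
  \<comment> \<open>The extra factor \<open>[:1, 1:]\<close> comes from starting at index 1: the
    lowest power available in \<open>shift_x\<close> is \<open>[:1, 1:] ^ Suc 0\<close>.\<close>
  have "[:1, 1:] * q \<in> annihilators f"
  proof (rule annihilatorsI)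
    fix b :: "int poly"
    \<comment> \<open>Every multiplier \<open>b\<close> arises by the substitution, so it can be
      absorbed on the side of \<open>x\<close>.\<close>
    have b: "pcompose (pcompose b [:- 1, 1:]) [:1, 1:] = b"
      by (simp add: pcompose_assoc[symmetric] pcompose_pCons)
    have "pairing f (b * ([:1, 1:] * q)) =
        pairing f ([:1, 1:] ^ Suc 0 * pcompose (pcompose b [:- 1, 1:] * min_char_poly x) [:1, 1:])"
      by (simp only: pcompose_mult b q_def power_Suc power_0 mult_1_left mult_1_right mult_ac)
    also have "\<dots> = 0"
      unfolding shift_x[of 0, symmetric] using pairing_mult_annihilator[OF P, of 0] by simp
    finally show "pairing f (b * ([:1, 1:] * q)) = 0" .
  qed
  then have f_ann: "pairing (\<lambda>i. f (n + i)) ([:1, 1:] * q) = 0" for n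
    unfolding annihilators_def by blast

  \<comment> \<open>Divisibility by the cyclotomic polynomial\<close>
  have "pairing (\<lambda>i. f' (n + i)) ([:1, 1:] * q) = 0" for n
  proof -
    have "(\<lambda>i. f' (n + i)) = (\<lambda>i. f ((n + 2 ^ m) + i) - f (n + i))"
      by (simp add: f'_def add_ac)
    then show ?thesis by (simp only: pairing_diff_left f_ann diff_self)
  qed
  then have "[:1, 1:] * q \<in> annihilators f'"
    unfolding annihilators_def by blast
  moreover have c_ann: "c \<in> annihilators f'"
  proof -
    \<comment> \<open>The sum telescopes to \<open>f (n + 2 ^ Suc m) - f n\<close>.\<close>
    have "f' (n + 2 ^ m) + f' n = 0" for n
      using period[of n] by (simp add: f'_def add.assoc mult_2)
    then show ?thesis
      by (simp add: c_def annihilators_def pairing_add one_pCons pairing_pCons)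
  qed
  moreover have lc: "lead_coeff c = 1"
    unfolding c_def by (rule lead_coeff_two_power_cyclotomic)
  obtain g where g: "lead_coeff g = 1" "annihilators f' = {p. g dvd p}"
    using saturated_ideal_generator[OF saturated_ideal_annihilators c_ann lc] .
  \<comment> \<open>As \<open>f'\<close> is nonzero, \<open>g\<close> is a nonunit divisor of the
    irreducible \<open>c\<close>; hence \<open>c\<close> divides \<open>g\<close> and with it every
    annihilator of \<open>f'\<close>.\<close>
  have "1 \<notin> annihilators f'"
    using f'_j0 by (auto simp: annihilators_def one_pCons pairing_pCons intro!: exI[of _ j0])
  then have "\<not> is_unit g" using g by simp
  moreover have c_irred: "irreducible c"
    unfolding c_def by (rule irreducible_two_power_cyclotomic)
  ultimately have "c dvd [:1, 1:] * q"
    using g(2) by (metis dvd_trans irreducible_altdef mem_Collect_eq)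
  then have "c dvd [:1, 1:] \<or> c dvd q"
    by (rule prime_elem_dvd_multD[OF irreducible_imp_prime_elem[OF c_irred]])
  moreover have "\<not> c dvd [:1, 1:]"
  proof
    assume "c dvd [:1, 1:]"
    then have "degree c \<le> degree [:1, 1 :: int:]" by (rule dvd_imp_degree_le) simp
    moreover have "(2::nat) ^ 1 \<le> 2 ^ m" using \<open>m \<noteq> 0\<close> by (intro power_increasing) auto
    ultimately show False by (simp add: c_def degree_two_power_cyclotomic)
  qed
  ultimately obtain h where "q = c * h" by (auto simp: dvd_def)
  then have "pcompose q [:- 1, 1:] = pcompose c [:- 1, 1:] * pcompose h [:- 1, 1:]"
    by (simp add: pcompose_mult)
  moreover have "pcompose q [:- 1, 1:] = min_char_poly x"
    by (simp add: q_def pcompose_assoc[symmetric] pcompose_pCons)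
  ultimately show ?thesis
    using cyclotomic_two_power[of m] by (simp add: r c_def x_def del: power_Suc)
qed

end
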